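(* For any integer $s\geq 2$, let $\theta(2^{[s-1]},4)$ denote the bridge graph consisting of $s-1$ internally disjoint $(u,v)$-paths of length $2$ together with one further internally disjoint $(u,v)$-path of length $4$. Then $\chi_{la}(\theta(2^{[s-1]}, 4))=3$.
   Context: For a connected graph $G=(V,E)$, a local antimagic labeling is a bijection $f:E\to\{1,\dots,|E|\}$ such that $f^+(x)\neq f^+(y)$ for every pair of adjacent vertices $x,y$, where $f^+(x)=\sum_{e\ni x} f(e)$ is the sum of labels of edges incident to $x$. The number of distinct values of $f^+$ is the color number $c(f)$, and the local antimagic chromatic number $\chi_{la}(G)$ is the minimum of $c(f)$ over all local antimagic labelings $f$ of $G$. A bridge graph ($s$-bridge graph) $\theta(a_1,\dots,a_s)$, $s\ge 2$, consists of two vertices $u,v$ joined by $s$ internally disjoint (edge-disjoint) $(u,v)$-paths of lengths $a_1,\dots,a_s$. The notation $a^{[n]}$ denotes $n$ consecutive entries equal to $a$. *)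

theory Defs
  imports "HOL-Library.Extended_Nat"
begin

text \<open>
  A finite simple graph is given by its vertex set and its edge set, an edge being the
  two-element set of its ends.
\<close>

definition connected_simple_graph :: "'a set \<Rightarrow> 'a set set \<Rightarrow> bool" where
  "connected_simple_graph V E \<longleftrightarrow>
     finite V \<and> V \<noteq> {} \<and> (\<forall>e\<in>E. e \<subseteq> V \<and> card e = 2) \<and>
     (\<forall>x\<in>V. \<forall>y\<in>V. (x, y) \<in> {(a, b). {a, b} \<in> E}\<^sup>*)"

definition vertex_sum :: "'a set set \<Rightarrow> ('a set \<Rightarrow> nat) \<Rightarrow> 'a \<Rightarrow> nat" where
  "vertex_sum E f x = (\<Sum>e | e \<in> E \<and> x \<in> e. f e)"

definition local_antimagic_labeling ::
  "'a set \<Rightarrow> 'a set set \<Rightarrow> ('a set \<Rightarrow> nat) \<Rightarrow> bool" where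
  "local_antimagic_labeling V E f \<longleftrightarrow>
     bij_betw f E {1..card E} \<and>
     (\<forall>x\<in>V. \<forall>y\<in>V. {x, y} \<in> E \<longrightarrow> vertex_sum E f x \<noteq> vertex_sum E f y)"

definition color_number :: "'a set \<Rightarrow> 'a set set \<Rightarrow> ('a set \<Rightarrow> nat) \<Rightarrow> nat" where
  "color_number V E f = card (vertex_sum E f ` V)"

text \<open>
  The infimum is taken in \<^typ>\<open>enat\<close>: it is a minimum whenever a local antimagic labeling
  exists, and \<open>\<infinity>\<close> (rather than an unspecified number) otherwise.
\<close>

definition chi_la :: "'a set \<Rightarrow> 'a set set \<Rightarrow> enat" where
  "chi_la V E = (INF f \<in> {f. local_antimagic_labeling V E f}. enat (color_number V E f))"

text \<open>
  The bridge graph with path lengths \<open>as = [a\<^sub>1, \<dots>, a\<^sub>s]\<close>. Paths are numbered from 0, and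
  \<open>bridge_path as i\<close> enumerates the vertices of path \<open>i\<close> from \<open>u\<close> (position \<open>0\<close>) to
  \<open>v\<close> (position \<open>as ! i\<close>). The lengths have to be positive. If two of them equal 1 the graph
  of the literature has parallel edges, which this edge-set encoding would identify.
\<close>

datatype bridge_vertex = End_u | End_v | Inner nat nat

definition bridge_path :: "nat list \<Rightarrow> nat \<Rightarrow> nat \<Rightarrow> bridge_vertex" where
  "bridge_path as i j =
     (if j = 0 then End_u else if j = as ! i then End_v else Inner i j)"

definition bridge_verts :: "nat list \<Rightarrow> bridge_vertex set" where
  "bridge_verts as = {End_u, End_v} \<union> {bridge_path as i j | i j. i < length as \<and> j \<le> as ! i}"

definition bridge_edges :: "nat list \<Rightarrow> bridge_vertex set set" where
  "bridge_edges as =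
     {{bridge_path as i j, bridge_path as i (Suc j)} | i j. i < length as \<and> j < as ! i}"

lemma bridge_connected_simple_graph:
  assumes "as \<noteq> []" and pos: "\<forall>a\<in>set as. 0 < a"
  shows "connected_simple_graph (bridge_verts as) (bridge_edges as)"
proof -
  let ?R = "{(a, b). {a, b} \<in> bridge_edges as}"
  have sym: "sym ?R" by (auto simp: sym_def insert_commute)
  have V: "bridge_verts as = {End_u, End_v} \<union>
      (\<lambda>(i, j). bridge_path as i j) ` (SIGMA i:{..<length as}. {..as ! i})"
    unfolding bridge_verts_def by (auto simp: image_def)
  have reach: "(End_u, bridge_path as i j) \<in> ?R\<^sup>*" if "i < length as" "j \<le> as ! i" for i j
    using that(2)
  proof (induction j)
    case 0
    then show ?case by (simp add: bridge_path_def)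
  next
    case (Suc j)
    have "{bridge_path as i j, bridge_path as i (Suc j)} \<in> bridge_edges as"
      using that(1) Suc.prems unfolding bridge_edges_def
      by (blast intro: Suc_le_lessD)
    then show ?case using Suc by (auto intro: rtrancl_into_rtrancl)
  qed
  have "End_v = bridge_path as 0 (as ! 0)"
    using assms by (auto simp: bridge_path_def)
  then have "(End_u, End_v) \<in> ?R\<^sup>*"
    using reach[of 0 "as ! 0"] assms(1) by simp
  then have from_u: "(End_u, x) \<in> ?R\<^sup>*" if "x \<in> bridge_verts as" for x
    using that reach unfolding bridge_verts_def by blast
  have "(x, y) \<in> ?R\<^sup>*" if "x \<in> bridge_verts as" "y \<in> bridge_verts as" for x y
    using from_u[OF that(1)] from_u[OF that(2)] sym_rtrancl[OF sym]
    by (meson rtrancl_trans symD)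
  moreover have "finite (bridge_verts as)" unfolding V by auto
  moreover have "e \<subseteq> bridge_verts as \<and> card e = 2" if "e \<in> bridge_edges as" for e
  proof -
    obtain i j where ij: "i < length as" "j < as ! i"
      "e = {bridge_path as i j, bridge_path as i (Suc j)}"
      using \<open>e \<in> bridge_edges as\<close> unfolding bridge_edges_def by blast
    have "bridge_path as i j \<noteq> bridge_path as i (Suc j)"
      using ij(2) by (auto simp: bridge_path_def)
    moreover have "bridge_path as i k \<in> bridge_verts as" if "k \<le> as ! i" for k
      using that ij(1) unfolding bridge_verts_def by blast
    ultimately show ?thesis using ij(2,3) by simp
  qed
  moreover have "bridge_verts as \<noteq> {}" unfolding bridge_verts_def by blast
  ultimately show ?thesis unfolding connected_simple_graph_def by blast
qed

end

theory Submission imports Defs begin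

text \<open>
  Write \<open>n = s - 1\<close>, so that there are \<open>2 * n + 4\<close> edges. Upper bound: label the two edges at a
  neighbour of an end by \<open>(2 * n + 5 \<plusminus> d) / 2\<close>, with \<open>\<bar>d\<bar>\<close> running through the odd numbers up to
  \<open>2 * n + 3\<close>. All these vertices get the sum \<open>2 * n + 5\<close>, and the signs can be
  chosen so that both ends get the same sum; the middle of the long path takes the third color.

  Lower bound: with only two colors, the bipartition classes are monochromatic. The edge labels
  add up to \<open>(n + 2) * (2 * n + 5)\<close>, so the larger class has color \<open>2 * n + 5\<close> and the class of three
  vertices has color \<open>(n + 2) * (2 * n + 5) / 3\<close>. The latter is a sum of two labels at the middle of
  the long path, which forces \<open>n \<le> 3\<close>, and only \<open>n = 2\<close> needs a search.
\<close>

section \<open>Edges of a bridge graph indexed by path and position\<close>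

text \<open>Naming edges by path and position turns sums and labelings over a set of vertex sets
  into functions of two indices.\<close>

definition bridge_edge :: "nat list \<Rightarrow> nat \<Rightarrow> nat \<Rightarrow> bridge_vertex set" where
  "bridge_edge as i j = {bridge_path as i j, bridge_path as i (Suc j)}"

definition bridge_index :: "nat list \<Rightarrow> (nat \<times> nat) set" where
  "bridge_index as = (SIGMA i:{..<length as}. {..<as ! i})"

lemma finite_bridge_index [simp]: "finite (bridge_index as)"
  by (simp add: bridge_index_def)

lemma card_bridge_index: "card (bridge_index as) = sum_list as"
  by (simp add: bridge_index_def sum_list_sum_nth atLeast0LessThan)

lemma bridge_edges_eq: "bridge_edges as = (\<lambda>(i, j). bridge_edge as i j) ` bridge_index as"
  unfolding bridge_edges_def bridge_edge_def bridge_index_def by force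

lemma bridge_edge_in_edges:
  "i < length as \<Longrightarrow> j < as ! i \<Longrightarrow> bridge_edge as i j \<in> bridge_edges as"
  unfolding bridge_edges_def bridge_edge_def by blast

text \<open>When all lengths are at least 2, every edge has an inner vertex, which reveals the path;
  its other vertex then fixes the position. Two paths of length 1 would share the edge between
  \<open>End_u\<close> and \<open>End_v\<close>.\<close>

lemma bridge_edge_inject:
  assumes "\<forall>a\<in>set as. 2 \<le> a" "i < length as" "j < as ! i" "i' < length as" "j' < as ! i'"
  shows "bridge_edge as i j = bridge_edge as i' j' \<longleftrightarrow> i = i' \<and> j = j'"
proof -
  have "2 \<le> as ! i" "2 \<le> as ! i'"
    using assms by auto
  then show ?thesis
    using assms(3,5) unfolding bridge_edge_def bridge_path_def
    by (auto simp: doubleton_eq_iff split: if_splits)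
qed

lemma inj_on_bridge_edge:
  assumes "\<forall>a\<in>set as. 2 \<le> a"
  shows "inj_on (\<lambda>(i, j). bridge_edge as i j) (bridge_index as)"
  by (auto simp: inj_on_def bridge_index_def bridge_edge_inject[OF assms])

lemma sum_bridge_edges:
  assumes "\<forall>a\<in>set as. 2 \<le> a"
  shows "sum f (bridge_edges as) = (\<Sum>i<length as. \<Sum>j<as ! i. f (bridge_edge as i j))"
proof -
  have "sum f (bridge_edges as) = (\<Sum>(i, j)\<in>bridge_index as. f (bridge_edge as i j))"
    unfolding bridge_edges_eq sum.reindex[OF inj_on_bridge_edge[OF assms]]
    by (simp add: o_def case_prod_unfold)
  then show ?thesis
    by (simp add: bridge_index_def sum.Sigma)
qed

lemma card_bridge_edges:
  assumes "\<forall>a\<in>set as. 2 \<le> a"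
  shows "card (bridge_edges as) = sum_list as"
  using sum_bridge_edges[OF assms, of "\<lambda>_. 1 :: nat"]
  by (simp add: sum_list_sum_nth atLeast0LessThan)

section \<open>Vertex sums and labelings in terms of the indices\<close>

lemma vertex_sum_End_u:
  assumes "\<forall>a\<in>set as. 2 \<le> a"
  shows "vertex_sum (bridge_edges as) f End_u = (\<Sum>i<length as. f (bridge_edge as i 0))"
proof -
  have pos: "0 < as ! i" if "i < length as" for i
    using assms that by (metis less_le_trans nth_mem pos2)
  have "{e \<in> bridge_edges as. End_u \<in> e} = (\<lambda>i. bridge_edge as i 0) ` {..<length as}"
  proof (intro equalityI subsetI)
    fix e assume "e \<in> {e \<in> bridge_edges as. End_u \<in> e}"
    then obtain i j where "i < length as" "e = bridge_edge as i j" "End_u \<in> e"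
      by (auto simp: bridge_edges_eq bridge_index_def)
    moreover from this have "j = 0"
      by (auto simp: bridge_edge_def bridge_path_def split: if_splits)
    ultimately show "e \<in> (\<lambda>i. bridge_edge as i 0) ` {..<length as}"
      by auto
  next
    fix e assume "e \<in> (\<lambda>i. bridge_edge as i 0) ` {..<length as}"
    then obtain i where i: "i < length as" "e = bridge_edge as i 0"
      by auto
    then have "End_u \<in> e"
      by (simp add: bridge_edge_def bridge_path_def)
    then show "e \<in> {e \<in> bridge_edges as. End_u \<in> e}"
      using i pos[of i] by (simp add: bridge_edge_in_edges)
  qed
  moreover have "inj_on (\<lambda>i. bridge_edge as i 0) {..<length as}"
    using pos by (auto simp: inj_on_def bridge_edge_inject[OF assms])
  ultimately show ?thesis
    unfolding vertex_sum_def by (simp add: sum.reindex)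
qed

lemma vertex_sum_End_v:
  assumes "\<forall>a\<in>set as. 2 \<le> a"
  shows "vertex_sum (bridge_edges as) f End_v = (\<Sum>i<length as. f (bridge_edge as i (as ! i - 1)))"
proof -
  have pos: "0 < as ! i" if "i < length as" for i
    using assms that by (metis less_le_trans nth_mem pos2)
  have "{e \<in> bridge_edges as. End_v \<in> e} = (\<lambda>i. bridge_edge as i (as ! i - 1)) ` {..<length as}"
  proof (intro equalityI subsetI)
    fix e assume "e \<in> {e \<in> bridge_edges as. End_v \<in> e}"
    then obtain i j where "i < length as" "j < as ! i" "e = bridge_edge as i j" "End_v \<in> e"
      by (auto simp: bridge_edges_eq bridge_index_def)
    \<comment> \<open>\<open>End_v\<close> sits only at position \<open>as ! i\<close>. Since
      \<open>j < as ! i\<close>, it has to be the later vertex of the edge, at position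
      \<open>Suc j\<close>.\<close>
    moreover from this have "j = as ! i - 1"
      by (auto simp: bridge_edge_def bridge_path_def split: if_splits)
    ultimately show "e \<in> (\<lambda>i. bridge_edge as i (as ! i - 1)) ` {..<length as}"
      by auto
  next
    fix e assume "e \<in> (\<lambda>i. bridge_edge as i (as ! i - 1)) ` {..<length as}"
    then obtain i where i: "i < length as" "e = bridge_edge as i (as ! i - 1)"
      by auto
    then have "End_v \<in> e"
      using pos[of i] by (auto simp: bridge_edge_def bridge_path_def)
    then show "e \<in> {e \<in> bridge_edges as. End_v \<in> e}"
      using i pos[of i] by (simp add: bridge_edge_in_edges)
  qed
  moreover have "inj_on (\<lambda>i. bridge_edge as i (as ! i - 1)) {..<length as}"
    using pos by (auto simp: inj_on_def bridge_edge_inject[OF assms])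
  ultimately show ?thesis
    unfolding vertex_sum_def by (simp add: sum.reindex)
qed

lemma vertex_sum_Inner:
  assumes "\<forall>a\<in>set as. 2 \<le> a" "i < length as" "Suc j < as ! i"
  shows "vertex_sum (bridge_edges as) f (Inner i (Suc j)) =
    f (bridge_edge as i j) + f (bridge_edge as i (Suc j))"
proof -
  have "{e \<in> bridge_edges as. Inner i (Suc j) \<in> e} = {bridge_edge as i j, bridge_edge as i (Suc j)}"
  proof (intro equalityI subsetI)
    fix e assume "e \<in> {e \<in> bridge_edges as. Inner i (Suc j) \<in> e}"
    then obtain i' j' where "e = bridge_edge as i' j'" "Inner i (Suc j) \<in> e"
      by (auto simp: bridge_edges_eq)
    then show "e \<in> {bridge_edge as i j, bridge_edge as i (Suc j)}"
      by (auto simp: bridge_edge_def bridge_path_def split: if_splits)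
  next
    fix e assume "e \<in> {bridge_edge as i j, bridge_edge as i (Suc j)}"
    moreover from this have "Inner i (Suc j) \<in> e"
      using assms(3) by (auto simp: bridge_edge_def bridge_path_def)
    ultimately show "e \<in> {e \<in> bridge_edges as. Inner i (Suc j) \<in> e}"
      using assms(2,3) by (auto intro: bridge_edge_in_edges)
  qed
  moreover have "bridge_edge as i j \<noteq> bridge_edge as i (Suc j)"
    using assms by (simp add: bridge_edge_inject)
  ultimately show ?thesis
    unfolding vertex_sum_def by simp
qed

text \<open>Labels prescribed on index pairs are carried to the edges by inverting the enumeration
  of the edges. The labeling of the upper bound can therefore be written as a formula in
  \<open>i\<close> and \<open>j\<close>.\<close>

lemma bridge_labeling_exists:
  assumes "\<forall>a\<in>set as. 2 \<le> a"
    and "bij_betw (\<lambda>(i, j). l i j) (bridge_index as) {1..sum_list as}"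
  obtains f where "bij_betw f (bridge_edges as) {1..card (bridge_edges as)}"
    and "\<And>i j. (i, j) \<in> bridge_index as \<Longrightarrow> f (bridge_edge as i j) = l i j"
proof -
  let ?e = "\<lambda>(i, j). bridge_edge as i j"
  let ?f = "(\<lambda>(i, j). l i j) \<circ> inv_into (bridge_index as) ?e"
  have "bij_betw ?e (bridge_index as) (bridge_edges as)"
    by (simp add: bij_betw_def inj_on_bridge_edge assms(1) bridge_edges_eq)
  then have "bij_betw ?f (bridge_edges as) {1..card (bridge_edges as)}"
    using assms by (auto intro: bij_betw_trans bij_betw_inv_into simp: card_bridge_edges)
  moreover have "?f (bridge_edge as i j) = l i j" if "(i, j) \<in> bridge_index as" for i j
    using inv_into_f_f[OF inj_on_bridge_edge[OF assms(1)] that] by simp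
  ultimately show thesis
    using that by blast
qed

section \<open>The graph with \<open>n\<close> paths of length 2 and one of length 4\<close>

lemma theta_lengths: "\<forall>a\<in>set (replicate n 2 @ [4 :: nat]). 2 \<le> a"
  by auto

lemma theta_nth:
  "i < n \<Longrightarrow> (replicate n 2 @ [4 :: nat]) ! i = 2" "(replicate n 2 @ [4 :: nat]) ! n = 4"
  by (simp_all add: nth_append)

lemma theta_vertices:
  "bridge_verts (replicate n 2 @ [4]) =
    {End_u, End_v, Inner n 1, Inner n 2, Inner n 3} \<union> (\<lambda>i. Inner i 1) ` {..<n}"
  (is "?V = ?R")
proof (intro equalityI subsetI)
  fix x assume "x \<in> ?V"
  then consider "x = End_u" | "x = End_v"
    | i j where "x = Inner i j" "i < Suc n" "0 < j" "j < (replicate n 2 @ [4]) ! i"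
    by (auto simp: bridge_verts_def bridge_path_def split: if_splits)
  then show "x \<in> ?R"
  proof cases
    case 3
    then have "i < n \<and> j = 1 \<or> i = n \<and> (j = 1 \<or> j = 2 \<or> j = 3)"
      by (cases "i = n") (simp_all add: theta_nth, linarith+)
    then show ?thesis
      using 3(1) by auto
  qed auto
next
  fix x assume "x \<in> ?R"
  moreover have "Inner i j \<in> ?V" if "i < Suc n" "0 < j" "j < (replicate n 2 @ [4]) ! i" for i j
  proof -
    have "Inner i j = bridge_path (replicate n 2 @ [4]) i j"
      using that by (simp add: bridge_path_def)
    then show ?thesis
      using that unfolding bridge_verts_def by auto (metis less_imp_le)
  qed
  ultimately show "x \<in> ?V"
    by (auto simp: theta_nth) (auto simp: bridge_verts_def)
qed

lemma theta_vertex_sums: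
  fixes n :: nat and f :: "bridge_vertex set \<Rightarrow> nat"
  defines "as \<equiv> replicate n 2 @ [4]"
  defines "S \<equiv> vertex_sum (bridge_edges as) f" and "E \<equiv> \<lambda>i j. f (bridge_edge as i j)"
  shows "S End_u = (\<Sum>i<n. E i 0) + E n 0"
    and "S End_v = (\<Sum>i<n. E i 1) + E n 3"
    and "\<And>i. i < n \<Longrightarrow> S (Inner i 1) = E i 0 + E i 1"
    and "S (Inner n 1) = E n 0 + E n 1"
    and "S (Inner n 2) = E n 1 + E n 2"
    and "S (Inner n 3) = E n 2 + E n 3"
proof -
  have two: "\<forall>a\<in>set as. 2 \<le> a" and len: "length as = Suc n"
    and nth: "\<And>i. i < n \<Longrightarrow> as ! i = 2" "as ! n = 4"
    by (auto simp: as_def theta_nth)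
  show "S End_u = (\<Sum>i<n. E i 0) + E n 0" "S End_v = (\<Sum>i<n. E i 1) + E n 3"
    by (simp_all add: S_def E_def vertex_sum_End_u[OF two] vertex_sum_End_v[OF two] len nth)
  note inner = vertex_sum_Inner[OF two, of _ _ f]
  show "S (Inner i 1) = E i 0 + E i 1" if "i < n" for i
    using inner[of i 0] that by (simp add: S_def E_def len nth)
  show "S (Inner n 1) = E n 0 + E n 1" "S (Inner n 2) = E n 1 + E n 2"
    "S (Inner n 3) = E n 2 + E n 3"
    using inner[of n 0] inner[of n 1] inner[of n 2]
    by (simp_all add: S_def E_def len nth numeral_2_eq_2 numeral_3_eq_3)
qed

lemma card_theta_edges: "card (bridge_edges (replicate n 2 @ [4])) = 2 * n + 4"
  by (simp add: card_bridge_edges[OF theta_lengths] sum_list_replicate)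

section \<open>Signed odd numbers that balance the two ends\<close>

text \<open>
  The four largest values extend a solution for \<open>n\<close> to one for \<open>n + 4\<close> because
  \<open>d - (d + 2) - (d + 4) + (d + 6) = 0\<close>.
\<close>

lemma signed_odd_numbers:
  assumes "1 \<le> n"
  shows "\<exists>e :: nat \<Rightarrow> int. (\<forall>i<n + 2. odd (e i) \<and> \<bar>e i\<bar> \<le> 2 * int n + 3) \<and>
    inj_on (\<lambda>i. \<bar>e i\<bar>) {..<n + 2} \<and> e 0 - e 1 + 2 * (\<Sum>i<n. e (i + 2)) = 0"
  using assms
proof (induction n rule: less_induct)
  case (less n)
  consider "n = 1" | "n = 2" | "n = 3" | "n = 4" | m where "n = m + 4" "1 \<le> m"
  proof -
    have "n = 1 \<or> n = 2 \<or> n = 3 \<or> n = 4 \<or> n = (n - 4) + 4 \<and> 1 \<le> n - 4"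
      using less.prems by linarith
    then show thesis
      using that by blast
  qed
  then show ?case
  proof cases
    \<comment> \<open>The base witnesses use each of 1, 3, ..., \<open>2 * n + 3\<close> once up to
      sign; here 5 + 1 - 2 * 3 = 0. Four of them are needed because the induction advances by
      4.\<close>
    case 1
    then show ?thesis
      by (intro exI[of _ "\<lambda>i. [5, -1, -3] ! i"])
        (simp add: inj_on_def numeral_eq_Suc All_less_Suc lessThan_Suc)
  next
    case 2
    then show ?thesis
      by (intro exI[of _ "\<lambda>i. [3, -1, 5, -7] ! i"])
        (simp add: inj_on_def numeral_eq_Suc All_less_Suc lessThan_Suc)
  next
    case 3
    then show ?thesis
      by (intro exI[of _ "\<lambda>i. [-9, 1, 3, -5, 7] ! i"])
        (simp add: inj_on_def numeral_eq_Suc All_less_Suc lessThan_Suc)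
  next
    case 4
    then show ?thesis
      by (intro exI[of _ "\<lambda>i. [1, 5, 7, 9, -3, -11] ! i"])
        (simp add: inj_on_def numeral_eq_Suc All_less_Suc lessThan_Suc)
  next
    case 5
    from less.IH[of m] 5 obtain e :: "nat \<Rightarrow> int" where
      e: "\<And>i. i < m + 2 \<Longrightarrow> odd (e i) \<and> \<bar>e i\<bar> \<le> 2 * int m + 3"
        "inj_on (\<lambda>i. \<bar>e i\<bar>) {..<m + 2}" "e 0 - e 1 + 2 * (\<Sum>i<m. e (i + 2)) = 0"
      by auto
    define e' where "e' = e(m + 2 := 2 * int m + 5, m + 3 := - (2 * int m + 7),
      m + 4 := - (2 * int m + 9), m + 5 := 2 * int m + 11)"
    have old: "e' i = e i" if "i < m + 2" for i
      using that by (simp add: e'_def)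
    have "odd (e' i) \<and> \<bar>e' i\<bar> \<le> 2 * int n + 3" if "i < n + 2" for i
    proof -
      have "i < m + 2 \<or> i = m + 2 \<or> i = m + 3 \<or> i = m + 4 \<or> i = m + 5"
        using that 5 by linarith
      then show ?thesis
        using e(1)[of i] 5 by (elim disjE) (simp_all add: e'_def)
    qed
    moreover have "inj_on (\<lambda>i. \<bar>e' i\<bar>) {..<n + 2}"
    proof -
      have small: "\<bar>e' i\<bar> \<le> 2 * int m + 3" if "i < m + 2" for i
        using e(1)[OF that] old[OF that] by simp
      \<comment> \<open>The new absolute values grow with the index and exceed
        \<open>2 * m + 3\<close>, so they clash neither with one another nor with the old
        ones.\<close>
      have large: "\<bar>e' i\<bar> = 2 * int i + 1" if "i < n + 2" "\<not> i < m + 2" for i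
      proof -
        have "i = m + 2 \<or> i = m + 3 \<or> i = m + 4 \<or> i = m + 5"
          using that 5 by linarith
        then show ?thesis
          by (elim disjE) (simp_all add: e'_def)
      qed
      show ?thesis
      proof (rule linorder_inj_onI')
        fix i j assume ij: "i \<in> {..<n + 2}" "j \<in> {..<n + 2}" "i < j"
        show "\<bar>e' i\<bar> \<noteq> \<bar>e' j\<bar>"
        proof (cases "j < m + 2")
          case True
          then show ?thesis
            using inj_onD[OF e(2), of i j] ij(3) by (auto simp: old)
        next
          case False
          then show ?thesis
            using small[of i] large[of i] large[of j] ij by (cases "i < m + 2") auto
        qed
      qed
    qed
    moreover have "e' 0 - e' 1 + 2 * (\<Sum>i<n. e' (i + 2)) = 0"
    proof -
      have "(\<Sum>i<n. e' (i + 2)) = (\<Sum>i<m. e' (i + 2)) + e' (m + 2) + e' (m + 3) + e' (m + 4) + e' (m + 5)"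
        unfolding 5 by (simp add: numeral_eq_Suc)
      also have "\<dots> = (\<Sum>i<m. e' (i + 2))"
        by (simp add: e'_def)
      also have "\<dots> = (\<Sum>i<m. e (i + 2))"
        by (simp add: old)
      finally show ?thesis
        using e(3) by (simp add: old)
    qed
    ultimately show ?thesis
      by blast
  qed
qed

section \<open>The local antimagic condition edge by edge\<close>

text \<open>Adjacent vertices are exactly consecutive positions on one path, and the inequality of
  their sums is symmetric, so each edge needs to be tested once and in one direction only.\<close>

lemma local_antimagic_labeling_bridge_iff:
  "local_antimagic_labeling (bridge_verts as) (bridge_edges as) f \<longleftrightarrow>
    bij_betw f (bridge_edges as) {1..card (bridge_edges as)} \<and>
    (\<forall>i<length as. \<forall>j<as ! i. vertex_sum (bridge_edges as) f (bridge_path as i j) \<noteq>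
      vertex_sum (bridge_edges as) f (bridge_path as i (Suc j)))"
  (is "?L \<longleftrightarrow> ?B \<and> ?R")
proof (intro iffI conjI)
  assume ?L
  then show ?B
    by (simp add: local_antimagic_labeling_def)
  show ?R
  proof (intro allI impI)
    fix i j assume ij: "i < length as" "j < as ! i"
    then have "bridge_path as i j \<in> bridge_verts as" "bridge_path as i (Suc j) \<in> bridge_verts as"
      unfolding bridge_verts_def by (blast intro: less_imp_le Suc_leI)+
    moreover have "{bridge_path as i j, bridge_path as i (Suc j)} \<in> bridge_edges as"
      using ij unfolding bridge_edges_def by blast
    ultimately show "vertex_sum (bridge_edges as) f (bridge_path as i j) \<noteq>
        vertex_sum (bridge_edges as) f (bridge_path as i (Suc j))"
      using \<open>?L\<close> unfolding local_antimagic_labeling_def by blast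
  qed
next
  assume BR: "?B \<and> ?R"
  have "vertex_sum (bridge_edges as) f x \<noteq> vertex_sum (bridge_edges as) f y"
    if xy: "{x, y} \<in> bridge_edges as" for x y
  proof -
    obtain i j where "i < length as" "j < as ! i"
      "{x, y} = {bridge_path as i j, bridge_path as i (Suc j)}"
      using xy unfolding bridge_edges_def by blast
    then show ?thesis
      using BR by (metis doubleton_eq_iff)
  qed
  then show ?L
    using BR unfolding local_antimagic_labeling_def by blast
qed

lemma theta_local_antimagic_iff:
  fixes n :: nat and f :: "bridge_vertex set \<Rightarrow> nat"
  defines "as \<equiv> replicate n 2 @ [4]"
  defines "S \<equiv> vertex_sum (bridge_edges as) f"
  shows "local_antimagic_labeling (bridge_verts as) (bridge_edges as) f \<longleftrightarrow>
    bij_betw f (bridge_edges as) {1..2 * n + 4} \<and>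
    (\<forall>i<n. S End_u \<noteq> S (Inner i 1) \<and> S (Inner i 1) \<noteq> S End_v) \<and>
    S End_u \<noteq> S (Inner n 1) \<and> S (Inner n 1) \<noteq> S (Inner n 2) \<and>
    S (Inner n 2) \<noteq> S (Inner n 3) \<and> S (Inner n 3) \<noteq> S End_v"
proof -
  have len: "length as = Suc n" and nth: "\<And>i. i < n \<Longrightarrow> as ! i = 2" "as ! n = 4"
    by (auto simp: as_def theta_nth)
  have four: "(\<forall>j<4. P j) \<longleftrightarrow> P 0 \<and> P 1 \<and> P 2 \<and> P 3" and two: "(\<forall>j<2. P j) \<longleftrightarrow> P 0 \<and> P 1"
    for P :: "nat \<Rightarrow> bool"
    by (auto simp: numeral_eq_Suc All_less_Suc)
  show ?thesis
    unfolding local_antimagic_labeling_bridge_iff len S_def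
    by (auto simp: All_less_Suc nth four two bridge_path_def card_theta_edges[of n, folded as_def]
        simp flip: numeral_2_eq_2)
qed

section \<open>Upper bound by an explicit labeling\<close>

lemma theta_three_colors:
  fixes n :: nat
  defines "as \<equiv> replicate n 2 @ [4]"
  assumes "1 \<le> n"
  shows "\<exists>f. local_antimagic_labeling (bridge_verts as) (bridge_edges as) f \<and>
    color_number (bridge_verts as) (bridge_edges as) f \<le> 3"
proof -
  obtain e :: "nat \<Rightarrow> int" where
    e: "\<And>i. i < n + 2 \<Longrightarrow> odd (e i)" "\<And>i. i < n + 2 \<Longrightarrow> \<bar>e i\<bar> \<le> 2 * int n + 3"
      "inj_on (\<lambda>i. \<bar>e i\<bar>) {..<n + 2}" "e 0 - e 1 + 2 * (\<Sum>i<n. e (i + 2)) = 0"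
    using signed_odd_numbers[OF \<open>1 \<le> n\<close>] by blast
  \<comment> \<open>\<open>t i j\<close> tells which value of \<open>e\<close> an edge uses. Each
    value serves exactly two edges, which meet at a neighbor of an end.\<close>
  define t where "t i j = (if i < n then i + 2 else if j < 2 then 0 else 1)" for i j :: nat
  \<comment> \<open>The two edges with the same value get opposite signs, so their labels add up to
    \<open>2 * n + 5\<close>. On the long path the signs are arranged so that the edges at
    \<open>End_u\<close> and \<open>End_v\<close> carry \<open>e 0\<close> and
    \<open>e 1\<close>.\<close>
  define d where "d i j = (if i = n then [e 0, - e 0, - e 1, e 1] ! j
    else if j = 0 then e (i + 2) else - e (i + 2))" for i j
  define l where "l i j = nat ((2 * int n + 5 + d i j) div 2)" for i j
  have index: "i < n \<and> j < 2 \<or> i = n \<and> j < 4" if "(i, j) \<in> bridge_index as" for i j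
    using that by (cases "i = n") (auto simp: bridge_index_def as_def theta_nth)
  have t: "t i j < n + 2" and d: "d i j = e (t i j) \<or> d i j = - e (t i j)"
    if "(i, j) \<in> bridge_index as" for i j
    using index[OF that] by (auto simp: t_def d_def numeral_eq_Suc less_Suc_eq)
  have l: "2 * int (l i j) = 2 * int n + 5 + d i j" "l i j \<in> {1..2 * n + 4}"
    if "(i, j) \<in> bridge_index as" for i j
  proof -
    have "odd (d i j)" "\<bar>d i j\<bar> \<le> 2 * int n + 3"
      using e(1,2)[OF t[OF that]] d[OF that] by auto
    then have "even (2 * int n + 5 + d i j)" "2 \<le> 2 * int n + 5 + d i j"
      "2 * int n + 5 + d i j \<le> 2 * (2 * int n + 4)"
      by auto
    then show "2 * int (l i j) = 2 * int n + 5 + d i j" "l i j \<in> {1..2 * n + 4}"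
      unfolding l_def by (auto elim!: evenE)
  qed
  \<comment> \<open>Equal labels give equal \<open>d\<close>, hence values of \<open>e\<close> that
    agree up to sign, hence equal \<open>t\<close>. The two edges with this \<open>t\<close> carry
    opposite values, and these differ because odd numbers are nonzero.\<close>
  have inj: "inj_on (\<lambda>(i, j). l i j) (bridge_index as)"
  proof (rule inj_onI, clarify)
    fix i j i' j' assume ij: "(i, j) \<in> bridge_index as" "(i', j') \<in> bridge_index as"
      and "l i j = l i' j'"
    then have dd: "d i j = d i' j'"
      using l(1) by (metis add_left_cancel)
    then have "\<bar>e (t i j)\<bar> = \<bar>e (t i' j')\<bar>"
      using d[OF ij(1)] d[OF ij(2)] by (metis abs_minus_cancel)
    then have tt: "t i j = t i' j'"
      using inj_onD[OF e(3)] t[OF ij(1)] t[OF ij(2)] by auto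
    have "e (t i j) \<noteq> 0"
      using e(1)[OF t[OF ij(1)]] by auto
    show "i = i' \<and> j = j'"
    proof (cases "i < n")
      case True
      with tt have "i' = i"
        using index[OF ij(2)] by (auto simp: t_def split: if_splits)
      moreover have "j = 0 \<or> j = 1" "j' = 0 \<or> j' = 1"
        using True index[OF ij(1)] index[OF ij(2)] \<open>i' = i\<close> by auto
      ultimately show ?thesis
        using dd \<open>e (t i j) \<noteq> 0\<close> True by (auto simp: t_def d_def)
    next
      case False
      then have "i = n" "i' = n"
        using tt index[OF ij(1)] index[OF ij(2)]
        by (auto simp: t_def split: if_splits)
      moreover have "j = 0 \<or> j = 1 \<or> j = 2 \<or> j = 3" "j' = 0 \<or> j' = 1 \<or> j' = 2 \<or> j' = 3"
        using index[OF ij(1)] index[OF ij(2)] \<open>i = n\<close> \<open>i' = n\<close> by auto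
      ultimately show ?thesis
        using dd \<open>e (t i j) \<noteq> 0\<close> tt by (elim disjE) (simp_all add: t_def d_def)
    qed
  qed
  have "bij_betw (\<lambda>(i, j). l i j) (bridge_index as) {1..sum_list as}"
    unfolding bij_betw_def
  proof (intro conjI card_subset_eq inj)
    show "(\<lambda>(i, j). l i j) ` bridge_index as \<subseteq> {1..sum_list as}"
      using l(2) by (force simp: as_def sum_list_replicate mult.commute)
    show "card ((\<lambda>(i, j). l i j) ` bridge_index as) = card {1..sum_list as}"
      by (simp add: card_image[OF inj] card_bridge_index)
  qed simp
  then obtain f where f: "bij_betw f (bridge_edges as) {1..card (bridge_edges as)}"
    "\<And>i j. (i, j) \<in> bridge_index as \<Longrightarrow> f (bridge_edge as i j) = l i j"
    by (rule bridge_labeling_exists[OF theta_lengths[of n, folded as_def]]) blast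
  define S where "S = vertex_sum (bridge_edges as) f"
  define K where "K = 2 * int n + 5"
  \<comment> \<open>Doubling avoids the division in the labels: twice a label is \<open>K\<close>
    plus a signed odd number.\<close>
  have fe: "2 * int (f (bridge_edge as i j)) = K + d i j" if "(i, j) \<in> bridge_index as" for i j
    using f(2) l(1) that by (simp add: K_def)
  have [simp]: "i < n \<Longrightarrow> (i, 0) \<in> bridge_index as" "i < n \<Longrightarrow> (i, 1) \<in> bridge_index as"
    "j < 4 \<Longrightarrow> (n, j) \<in> bridge_index as" for i j
    by (auto simp: bridge_index_def as_def theta_nth)
  have di [simp]: "i < n \<Longrightarrow> d i 0 = e (i + 2)" "i < n \<Longrightarrow> d i 1 = - e (i + 2)"
    "d n 0 = e 0" "d n 1 = - e 0" "d n 2 = - e 1" "d n 3 = e 1" for i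
    by (simp_all add: d_def)
  note S = theta_vertex_sums[where n = n and f = f, folded as_def, folded S_def]
  define X where "X = (\<Sum>i<n. e (i + 2))"
  have "2 * int (S End_u) = (\<Sum>i<n. 2 * int (f (bridge_edge as i 0))) + 2 * int (f (bridge_edge as n 0))"
    by (simp add: S sum_distrib_left)
  also have "\<dots> = (\<Sum>i<n. K + e (i + 2)) + K + e 0"
    by (simp add: fe del: One_nat_def)
  finally have u: "2 * int (S End_u) = int n * K + X + K + e 0"
    by (simp add: sum.distrib X_def)
  have "2 * int (S End_v) = (\<Sum>i<n. 2 * int (f (bridge_edge as i 1))) + 2 * int (f (bridge_edge as n 3))"
    by (simp add: S sum_distrib_left)
  also have "\<dots> = (\<Sum>i<n. K - e (i + 2)) + K + e 1"
    by (simp add: fe del: One_nat_def)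
  finally have v: "2 * int (S End_v) = int n * K - X + K + e 1"
    by (simp add: sum.distrib sum_subtractf X_def)
  have m: "int (S (Inner i 1)) = K" if "i < n" for i
    using fe[of i 0] fe[of i 1] that by (simp add: S del: One_nat_def)
  have a: "int (S (Inner n 1)) = K" and b: "2 * int (S (Inner n 2)) = 2 * K - e 0 - e 1"
    and c: "int (S (Inner n 3)) = K"
    using fe[of n 0] fe[of n 1] fe[of n 2] fe[of n 3] by (simp_all add: S del: One_nat_def)
  \<comment> \<open>Twice the difference of the end sums is \<open>2 * X + e 0 - e 1\<close>, which
    vanishes by the choice of \<open>e\<close>.\<close>
  have uv: "S End_u = S End_v"
    using u v e(4) by (simp add: X_def)
  have "\<bar>e 0\<bar> \<noteq> \<bar>e 1\<bar>"
    using inj_onD[OF e(3), of 0 1] by auto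
  then have e01: "e 0 + e 1 \<noteq> 0"
    by linarith
  have bK: "int (S (Inner n 2)) \<noteq> K"
    using b e01 by linarith
  \<comment> \<open>If both ends had sum \<open>K\<close>, adding \<open>u\<close> and
    \<open>v\<close> would give \<open>e 0 + e 1 = (2 - 2 * n) * K\<close>. The left side exceeds
    \<open>- 2 * K\<close>, which leaves only \<open>n = 1\<close>, and then
    \<open>e 0 + e 1 = 0\<close>, contradicting \<open>e01\<close>.\<close>
  have uK: "int (S End_u) \<noteq> K"
  proof
    assume "int (S End_u) = K"
    then have *: "e 0 + e 1 = (2 - 2 * int n) * K"
      using u v uv by (simp add: algebra_simps)
    moreover have "- 2 * K < e 0 + e 1"
      using e(2)[of 0] e(2)[of 1] by (simp add: K_def)
    ultimately have "(2 * int n - 2) * K < 2 * K"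
      by (simp add: algebra_simps)
    then have "2 * int n - 2 < 2"
      unfolding mult_less_cancel_right by (auto simp: K_def)
    with \<open>1 \<le> n\<close> have "n = 1"
      by simp
    with * e01 show False
      by simp
  qed
  have "local_antimagic_labeling (bridge_verts as) (bridge_edges as) f"
    unfolding as_def theta_local_antimagic_iff
  proof (fold as_def S_def, intro conjI allI impI)
    show "bij_betw f (bridge_edges as) {1..2 * n + 4}"
      using f(1) by (simp add: as_def card_theta_edges)
  qed (metis m a bK c uv uK)+
  moreover have "color_number (bridge_verts as) (bridge_edges as) f \<le> 3"
  proof -
    have "S (Inner n 1) = nat K" "S (Inner n 3) = nat K" "\<And>i. i < n \<Longrightarrow> S (Inner i 1) = nat K"
      using m a c by (metis nat_int)+
    then have "S ` bridge_verts as \<subseteq> {nat K, S End_u, S (Inner n 2)}"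
      unfolding as_def theta_vertices by (auto simp: uv simp del: One_nat_def)
    then have "card (S ` bridge_verts as) \<le> card {nat K, S End_u, S (Inner n 2)}"
      by (intro card_mono) auto
    also have "\<dots> \<le> 3"
      by (simp add: card_insert_if)
    finally show ?thesis
      by (simp add: color_number_def S_def)
  qed
  ultimately show ?thesis
    by blast
qed

section \<open>Lower bound by excluding two colors\<close>

text \<open>This is the case \<open>n = 2\<close> with colors 9 and 12: \<open>p, q, r, t\<close>
  label the long path, \<open>x0, y0\<close> and \<open>x1, y1\<close> the short ones. The label
  \<open>p\<close> determines the long path, and \<open>p \<noteq> t\<close> excludes
  \<open>p = 3\<close>. For each other \<open>p\<close>, no two of the four remaining labels add up
  to \<open>12 - p\<close>, as \<open>x0\<close> and \<open>x1\<close> must.\<close>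

lemma theta_2_2_4_labels:
  fixes p q r t x0 y0 x1 y1 :: nat
  assumes "{p, q, r, t, x0, y0, x1, y1} \<subseteq> {1..8}" "distinct [p, q, r, t, x0, y0, x1, y1]"
    and "p + q = 9" "r + t = 9" "q + r = 12" "x0 + y0 = 9" "x1 + y1 = 9"
    and "x0 + x1 + p = 12" "y0 + y1 + t = 12"
  shows False
proof -
  have eqs: "q = 9 - p" "r = 3 + p" "t = 6 - p" "x1 = 12 - p - x0"
    using assms(3-) by linarith+
  have ranges: "1 \<le> x1" "x1 \<le> 8"
    using assms(1) by auto
  have "p \<noteq> t" "1 \<le> p" "1 \<le> t"
    using assms(1,2) by auto
  then have "p = 1 \<or> p = 2 \<or> p = 4 \<or> p = 5"
    using eqs(3) by linarith
  moreover have "x0 = 1 \<or> x0 = 2 \<or> x0 = 3 \<or> x0 = 4 \<or> x0 = 5 \<or> x0 = 6 \<or> x0 = 7 \<or> x0 = 8"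
    using assms(1) by auto
  moreover have "x0 \<notin> {p, q, r, t}" "x1 \<notin> {p, q, r, t}"
    using assms(2) by auto
  ultimately show False
    using ranges unfolding eqs by (elim disjE) simp_all
qed

lemma theta_color_number_ge:
  fixes n :: nat
  defines "as \<equiv> replicate n 2 @ [4]"
  assumes "1 \<le> n" and f: "local_antimagic_labeling (bridge_verts as) (bridge_edges as) f"
  shows "3 \<le> color_number (bridge_verts as) (bridge_edges as) f"
proof (rule ccontr)
  assume few: "\<not> ?thesis"
  define S where "S = vertex_sum (bridge_edges as) f"
  define g where "g i j = f (bridge_edge as i j)" for i j
  define K where "K = S (Inner n 1)"
  define L where "L = S End_u"
  note S = theta_vertex_sums[where n = n and f = f, folded as_def, folded S_def g_def]
  have adj: "bij_betw f (bridge_edges as) {1..2 * n + 4}"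
    "\<And>i. i < n \<Longrightarrow> L \<noteq> S (Inner i 1)" "K \<noteq> L" "K \<noteq> S (Inner n 2)"
    "S (Inner n 2) \<noteq> S (Inner n 3)" "S (Inner n 3) \<noteq> S End_v"
    using f unfolding as_def theta_local_antimagic_iff
    by (fold as_def S_def K_def L_def) auto
  have mem: "Inner n 1 \<in> bridge_verts as" "End_u \<in> bridge_verts as"
    by (auto simp: as_def theta_vertices)
  have "finite (bridge_verts as)"
    by (simp add: as_def theta_vertices)
  \<comment> \<open>The adjacent vertices \<open>Inner n 1\<close> and \<open>End_u\<close> already
    show two colors, so having fewer than three means having exactly \<open>K\<close> and
    \<open>L\<close>.\<close>
  moreover have "card (S ` bridge_verts as) \<le> card {K, L}"
    using few \<open>K \<noteq> L\<close> by (simp add: color_number_def S_def)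
  moreover have "{K, L} \<subseteq> S ` bridge_verts as"
    using mem unfolding K_def L_def by blast
  ultimately have "S ` bridge_verts as = {K, L}"
    by (metis card_seteq finite_imageI)
  then have KL: "S x = K \<or> S x = L" if "x \<in> bridge_verts as" for x
    using that by blast
  \<comment> \<open>From here the colors alternate along each path: a neighbor of a vertex of color
    \<open>L\<close> has color \<open>K\<close>, and conversely.\<close>
  have m: "g i 0 + g i 1 = K" if "i < n" for i
    using KL[of "Inner i 1"] adj(2)[OF that] that S(3)[OF that]
    by (auto simp: as_def theta_vertices)
  have b: "g n 1 + g n 2 = L"
    using KL[of "Inner n 2"] adj(4) S(5) by (auto simp: as_def theta_vertices)
  have c: "g n 2 + g n 3 = K"
    using KL[of "Inner n 3"] adj(5) S(5,6) b by (auto simp: as_def theta_vertices)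
  have v: "(\<Sum>i<n. g i 1) + g n 3 = L"
    using KL[of End_v] adj(6) S(2,6) c by (auto simp: as_def theta_vertices)
  have u: "(\<Sum>i<n. g i 0) + g n 0 = L"
    using S(1) by (simp add: L_def)
  have a: "g n 0 + g n 1 = K"
    using S(4) by (simp add: K_def)
  have mm: "(\<Sum>i<n. g i 0) + (\<Sum>i<n. g i 1) = n * K"
    using m by (simp flip: sum.distrib)
  have two: "\<forall>a\<in>set as. 2 \<le> a"
    unfolding as_def by (rule theta_lengths)
  have len: "length as = Suc n" and nth: "\<And>i. i < n \<Longrightarrow> as ! i = 2" "as ! n = 4"
    by (auto simp: as_def theta_nth)
  have "sum f (bridge_edges as) = \<Sum>{1..2 * n + 4}"
    using sum.reindex_bij_betw[OF adj(1), of id] by (simp add: id_def)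
  also have "\<dots> = (n + 2) * (2 * n + 5)"
    using gauss_sum_from_Suc_0[of "2 * n + 4", where 'a = nat] by (simp add: algebra_simps)
  \<comment> \<open>The \<open>n + 2\<close> neighbors of the ends all have color \<open>K\<close>,
    and each edge contains exactly one of them.\<close>
  also have "sum f (bridge_edges as) = (n + 2) * K"
  proof -
    have "sum f (bridge_edges as) = (\<Sum>i<n. g i 0 + g i 1) + (g n 0 + g n 1 + g n 2 + g n 3)"
      unfolding sum_bridge_edges[OF two] by (simp add: len nth g_def numeral_eq_Suc)
    then show ?thesis
      using m a c by simp
  qed
  finally have K: "K = 2 * n + 5"
    by (metis add_is_0 mult_left_cancel zero_neq_numeral)
  \<comment> \<open>Each edge also contains exactly one of \<open>End_u\<close>,
    \<open>End_v\<close> and \<open>Inner n 2\<close>, so three times \<open>L\<close> is again the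
    sum of all labels.\<close>
  have L: "3 * L = (n + 2) * K"
    using mm a b c u v by (simp add: algebra_simps)
  have range: "g i j \<in> {1..2 * n + 4}" if "i < length as" "j < as ! i" for i j
    unfolding g_def using adj(1) bridge_edge_in_edges[OF that] by (auto dest: bij_betwE)
  have distinct: "g i j = g i' j' \<longleftrightarrow> i = i' \<and> j = j'"
    if "i < length as" "j < as ! i" "i' < length as" "j' < as ! i'" for i j i' j'
    unfolding g_def bridge_edge_inject[OF two that, symmetric]
    using adj(1) that by (intro inj_on_eq_iff) (auto simp: bij_betw_def bridge_edge_in_edges)
  \<comment> \<open>As a sum of two labels, \<open>L\<close> is at most \<open>4 * n + 8\<close>,
    which is below \<open>2 * K\<close>; hence \<open>n + 2 < 6\<close>.\<close>
  have "g n 1 \<le> 2 * n + 4" "g n 2 \<le> 2 * n + 4"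
    using range[of n 1] range[of n 2] by (simp_all add: len nth)
  then have "(n + 2) * (2 * n + 5) < 6 * (2 * n + 5)"
    using L K b by simp
  then have "n < 4"
    unfolding mult_less_cancel2 by simp
  then consider "n = 1" | "n = 2" | "n = 3"
    using \<open>1 \<le> n\<close> by linarith
  then show False
  \<comment> \<open>For \<open>n = 1\<close> the colors would coincide, and for \<open>n = 3\<close>
    the number 55 is not divisible by 3. Counting leaves \<open>n = 2\<close>, where the labels
    themselves must be examined.\<close>
  proof cases
    case 1
    then show False
      using L K \<open>K \<noteq> L\<close> by simp
  next
    case 2
    have LK: "L = 12" "K = 9"
      using 2 L K by simp_all
    note as2 = len[unfolded 2] nth[unfolded 2] range[unfolded 2] distinct[unfolded 2]
    show False
    proof (rule theta_2_2_4_labels)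
      show "{g 2 0, g 2 1, g 2 2, g 2 3, g 0 0, g 0 1, g 1 0, g 1 1} \<subseteq> {1..8}"
        using as2(4) by (simp add: as2(1-3))
      show "distinct [g 2 0, g 2 1, g 2 2, g 2 3, g 0 0, g 0 1, g 1 0, g 1 1]"
        by (simp add: as2)
      show "g 2 0 + g 2 1 = 9" "g 2 2 + g 2 3 = 9" "g 2 1 + g 2 2 = 12"
        "g 0 0 + g 0 1 = 9" "g 1 0 + g 1 1 = 9"
        using a b c m[of 0] m[of 1] by (simp_all add: 2 LK)
      show "g 0 0 + g 1 0 + g 2 0 = 12" "g 0 1 + g 1 1 + g 2 3 = 12"
        using u v by (simp_all add: 2 LK numeral_2_eq_2)
    qed
  next
    case 3
    then have "3 * L = 55"
      using L K by simp
    then show False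
      by presburger
  qed
qed

section \<open>Both bounds combined into the value of the infimum\<close>

theorem theorem2p2:
  fixes s :: nat
  assumes "s \<ge> 2"
  shows "chi_la (bridge_verts (replicate (s - 1) 2 @ [4]))
                (bridge_edges (replicate (s - 1) 2 @ [4])) = 3"
proof (rule antisym)
  let ?as = "replicate (s - 1) 2 @ [4]"
  have n: "1 \<le> s - 1"
    using assms by simp
  obtain f where "local_antimagic_labeling (bridge_verts ?as) (bridge_edges ?as) f"
    "color_number (bridge_verts ?as) (bridge_edges ?as) f \<le> 3"
    using theta_three_colors[OF n] by blast
  then show "chi_la (bridge_verts ?as) (bridge_edges ?as) \<le> 3"
    unfolding chi_la_def by (intro INF_lower2[of f]) (auto simp: numeral_eq_enat)
  show "3 \<le> chi_la (bridge_verts ?as) (bridge_edges ?as)"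
    unfolding chi_la_def
    using theta_color_number_ge[OF n] by (intro INF_greatest) (auto simp: numeral_eq_enat)
qed

end
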